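(* There exist absolute constants $c > 0$ and $K > 0$ such that for every integer $n \geq 5$ there exists a generating set $S$ of $A_n^2 = A_n \times A_n$ with $|S| = 2$ and $$\mathrm{diam}(A_n^2, S) \leq K\, n\, e^{(c+1)(\log n)^4 \log\log n}.$$
   Context: $A_n$ is the alternating group on $n$ letters and $\log$ is the natural logarithm. A subset $A$ of a finite group $G$ is a generating set of $G$ if every element of $G$ is a product of elements of $A$ (inverses are not needed because $G$ is finite). For a generating set $A$ of $G$ and $g \in G$, the length $l_A(g)$ is the minimum length of a word in elements of $A$ (no inverses allowed) whose product is $g$, with $l_A(1)=0$. The diameter is $\mathrm{diam}(G,A) := \max\{l_A(g) : g \in G\}$. *)

theory Defs
  imports Complex_Main "HOL-Algebra.Sym_Groups"
begin

definition word_prod :: "('a, 'b) monoid_scheme \<Rightarrow> 'a list \<Rightarrow> 'a"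
  where "word_prod G w = foldr (\<otimes>\<^bsub>G\<^esub>) w \<one>\<^bsub>G\<^esub>"

text \<open>Words are positive, i.e. without inverses. For finite \<open>G\<close>, to which the notion is
  applied, this is the same as generating \<open>G\<close> as a group.\<close>

definition generating_set :: "('a, 'b) monoid_scheme \<Rightarrow> 'a set \<Rightarrow> bool"
  where "generating_set G A \<longleftrightarrow>
    A \<subseteq> carrier G \<and> (\<forall>g\<in>carrier G. \<exists>w\<in>lists A. word_prod G w = g)"

text \<open>\<open>LEAST\<close> and \<open>Max\<close> below are meaningful only when \<open>A\<close> generates \<open>G\<close> and
  \<open>carrier G\<close> is finite and nonempty.\<close>

definition word_length :: "('a, 'b) monoid_scheme \<Rightarrow> 'a set \<Rightarrow> 'a \<Rightarrow> nat"
  where "word_length G A g = (LEAST k. \<exists>w\<in>lists A. length w = k \<and> word_prod G w = g)"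

definition diam :: "('a, 'b) monoid_scheme \<Rightarrow> 'a set \<Rightarrow> nat"
  where "diam G A = Max (word_length G A ` carrier G)"

lemma word_length_one: "word_length G A \<one>\<^bsub>G\<^esub> = 0"
  unfolding word_length_def by (rule Least_eq_0) (auto simp: word_prod_def)

end

theory Submission
  imports Defs
begin

text \<open>Let \<open>x\<close> be a 3-cycle and \<open>y\<close> an even permutation with \<open>y ^^ m = id\<close>, \<open>m \<le> n\<close>,
  \<open>\<not> 3 dvd m\<close>, such that \<open>x\<close> and \<open>y\<close> generate \<open>A\<^sub>n\<close>. The generators are \<open>(x, y)\<close> and \<open>(y, x)\<close>.
  As \<open>m\<^sup>2 \<equiv> 1\<close> modulo 3, the power \<open>(x, y) ^^ m\<^sup>2\<close> is \<open>(x, id)\<close>. Its conjugates give all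
  \<open>(t, id)\<close> with \<open>t\<close> a 3-cycle: the conjugating words are paths in the action on the \<open>n\<^sup>3\<close>
  triples of points, so their length is polynomial in \<open>n\<close>. An even permutation is a product of
  at most \<open>n\<close> 3-cycles, and the second factor follows by symmetry, so the diameter is at most
  \<open>10 n\<^sup>8\<close>. This is dominated by the quasipolynomial bound since \<open>ln (ln n) \<ge> 1/4\<close> for
  \<open>n \<ge> 5\<close>.\<close>

section \<open>Closed sets of permutations containing 3-cycles\<close>

definition cyc3 :: "'a \<Rightarrow> 'a \<Rightarrow> 'a \<Rightarrow> 'a \<Rightarrow> 'a"
  where "cyc3 a b c = cycle_of_list [a, b, c]"

lemma cyc3_apply:
  assumes "distinct [a, b, c]"
  shows "cyc3 a b c a = b" "cyc3 a b c b = c" "cyc3 a b c c = a"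
    and "z \<noteq> a \<Longrightarrow> z \<noteq> b \<Longrightarrow> z \<noteq> c \<Longrightarrow> cyc3 a b c z = z"
  using assms by (auto simp: cyc3_def)

lemma cyc3_rotate:
  assumes "distinct [a, b, c]"
  shows "cyc3 b c a = cyc3 a b c"
  using assms by (auto simp: cyc3_def fun_eq_iff Transposition.transpose_def)

lemma cyc3_reverse:
  assumes "distinct [a, b, c]"
  shows "cyc3 c b a = cyc3 a b c \<circ> cyc3 a b c"
  using assms by (auto simp: cyc3_def fun_eq_iff Transposition.transpose_def)

lemma cyc3_cube:
  assumes "distinct [a, b, c]"
  shows "cyc3 a b c \<circ> cyc3 a b c \<circ> cyc3 a b c = id"
  using assms by (auto simp: cyc3_def fun_eq_iff Transposition.transpose_def)

lemma cyc3_permutes: "{a, b, c} \<subseteq> S \<Longrightarrow> cyc3 a b c permutes S"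
  using permutes_subset[OF cycle_permutes[of "[a, b, c]"], of S] by (simp add: cyc3_def)

lemma bij_cyc3: "bij (cyc3 a b c)"
  using permutes_bij[OF cyc3_permutes[OF subset_UNIV]] .

lemma evenperm_cyc3:
  assumes "distinct [a, b, c]"
  shows "evenperm (cyc3 a b c)"
proof -
  have "swapidseq (Suc (Suc 0)) (cyc3 a b c)"
    using comp_Suc[OF comp_Suc[OF id], of b c a b] assms by (simp add: cyc3_def)
  then show ?thesis
    by (simp add: evenperm_unique)
qed

lemma inv_cyc3:
  assumes "distinct [a, b, c]"
  shows "inv' (cyc3 a b c) = cyc3 c b a"
  using cyc3_cube[OF assms] by (intro inv_unique_comp) (auto simp: cyc3_reverse[OF assms] o_assoc)

lemma cyc3_conj:
  assumes "distinct [a, b, c]" "bij p"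
  shows "p \<circ> cyc3 a b c \<circ> inv' p = cyc3 (p a) (p b) (p c)"
  using conjugation_of_cycle[of "[a, b, c]" p] assms by (simp add: cyc3_def)

section \<open>Enlarging a set of points all of whose 3-cycles are available\<close>

definition contains_cyc3s :: "('a \<Rightarrow> 'a) set \<Rightarrow> 'a set \<Rightarrow> bool"
  where "contains_cyc3s H D \<longleftrightarrow> (\<forall>a\<in>D. \<forall>b\<in>D. \<forall>c\<in>D. distinct [a, b, c] \<longrightarrow> cyc3 a b c \<in> H)"

context
  fixes H :: "('a \<Rightarrow> 'a) set"
  assumes comp_closed: "f \<in> H \<Longrightarrow> g \<in> H \<Longrightarrow> f \<circ> g \<in> H"
begin

text \<open>The inverse of a 3-cycle is its square, so closure under composition also yields
  inverses of 3-cycles.\<close>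

lemma reverse_closed:
  assumes "cyc3 a b c \<in> H" "distinct [a, b, c]"
  shows "cyc3 c b a \<in> H"
  using assms(1) comp_closed by (simp add: cyc3_reverse[OF assms(2)])

lemma conj_closed:
  assumes "cyc3 a b c \<in> H" "distinct [a, b, c]" "cyc3 p q r \<in> H" "distinct [p, q, r]"
  shows "cyc3 (cyc3 p q r a) (cyc3 p q r b) (cyc3 p q r c) \<in> H"
proof -
  have "cyc3 p q r \<circ> cyc3 a b c \<circ> inv' (cyc3 p q r) \<in> H"
    using assms comp_closed reverse_closed by (simp add: inv_cyc3)
  then show ?thesis
    using assms by (simp add: cyc3_conj bij_cyc3)
qed

text \<open>Conjugation by 3-cycles on \<open>D\<close> replaces \<open>p\<close> and
  \<open>r\<close> by any two other points of \<open>D\<close>, so one 3-cycle through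
  \<open>u\<close> and two points of \<open>D\<close> yields all of them.\<close>

lemma contains_cyc3s_insert1:
  assumes D: "contains_cyc3s H D" "p \<in> D" "r \<in> D" "u \<notin> D" "p \<noteq> r" and "cyc3 p r u \<in> H"
  shows "contains_cyc3s H (insert u D)"
proof -
  define Q where "Q p r \<longleftrightarrow> p \<in> D \<and> r \<in> D \<and> p \<noteq> r \<and> cyc3 p r u \<in> H" for p r
  have swap: "Q r p" if "Q p r" for p r
  proof -
    have "p \<noteq> u" "r \<noteq> u"
      using that D(4) by (auto simp: Q_def)
    then show ?thesis
      using reverse_closed[of p r u] cyc3_rotate[of u r p] that by (auto simp: Q_def)
  qed
  have move: "Q p' r" if "Q p r" "p' \<in> D" "p' \<noteq> r" for p r p'
  proof (cases "p' = p")
    case False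
    have ne: "p \<noteq> u" "r \<noteq> u" "p' \<noteq> u" "p \<noteq> r"
      using that D(4) by (auto simp: Q_def)
    have "cyc3 p r p' \<in> H"
      using that False D(1) by (auto simp: Q_def contains_cyc3s_def)
    moreover have "cyc3 r p u \<in> H"
      using swap[OF that(1)] by (simp add: Q_def)
    ultimately have "cyc3 p' r u \<in> H"
      using conj_closed[of r p u p r p'] that ne False by (auto simp: Q_def cyc3_apply)
    then show ?thesis
      using that by (simp add: Q_def)
  qed (use that in simp)
  have "Q p r"
    using assms by (simp add: Q_def)
  \<comment> \<open>\<open>move\<close> changes only the first entry, so the second is changed
    between two swaps. The case \<open>p' = r\<close> is treated apart, since moving
    \<open>p\<close> to \<open>p'\<close> first would make both entries equal.\<close>
  have all: "Q p' r'" if "p' \<in> D" "r' \<in> D" "p' \<noteq> r'" for p' r'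
  proof (cases "p' = r")
    case True
    then show ?thesis
      using swap[OF move[OF \<open>Q p r\<close>, of r']] that by simp
  next
    case False
    then show ?thesis
      using swap[OF move[OF swap[OF move[OF \<open>Q p r\<close>, of p']], of r']] that by simp
  qed
  show ?thesis
    unfolding contains_cyc3s_def
  proof (intro ballI impI)
    fix a b c
    assume abc: "a \<in> insert u D" "b \<in> insert u D" "c \<in> insert u D" "distinct [a, b, c]"
    show "cyc3 a b c \<in> H"
    proof (cases "u \<in> {a, b, c}")
      case False
      then show ?thesis
        using abc D(1) by (auto simp: contains_cyc3s_def)
    next
      case True
      then consider "a = u" | "b = u" | "c = u" by blast
      then show ?thesis
      proof cases
        case 1
        then show ?thesis using abc all[of b c] cyc3_rotate[of a b c] by (auto simp: Q_def)
      next
        case 2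
        then show ?thesis using abc all[of c a] cyc3_rotate[of c a b] by (auto simp: Q_def)
      next
        case 3
        then show ?thesis using abc all[of a b] by (auto simp: Q_def)
      qed
    qed
  qed
qed

text \<open>If \<open>v\<close> is in \<open>D\<close>, then \<open>contains_cyc3s_insert1\<close>
  applies directly. Otherwise the 3-cycle meets \<open>D\<close> only in \<open>z\<close>:
  conjugation turns \<open>cyc3 z u v\<close> into \<open>cyc3 d u v\<close>, and these two together
  give \<open>cyc3 z d u\<close>, which has two points in \<open>D\<close>.\<close>

lemma contains_cyc3s_insert:
  assumes D: "contains_cyc3s H D" and def: "{z, d, e} \<subseteq> D" "distinct [z, d, e]"
    and "u \<notin> D" and v: "distinct [z, u, v]" and H: "cyc3 z u v \<in> H"
  shows "contains_cyc3s H (insert u D)"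
proof (cases "v \<in> D")
  case True
  then show ?thesis
    using contains_cyc3s_insert1[of D v z u] assms cyc3_rotate[of v z u] by auto
next
  case False
  have ne: "d \<noteq> u" "e \<noteq> u" "d \<noteq> v" "e \<noteq> v"
    using assms False by auto
  have "cyc3 z d e \<in> H"
    using D def by (auto simp: contains_cyc3s_def)
  then have "cyc3 d u v \<in> H"
    using conj_closed[of z u v z d e] assms ne by (auto simp: cyc3_apply)
  then have "cyc3 v u d \<in> H"
    using reverse_closed[of d u v] assms ne by auto
  then have "cyc3 z d u \<in> H"
    using conj_closed[of z u v v u d] assms ne by (auto simp: cyc3_apply)
  then show ?thesis
    using contains_cyc3s_insert1[of D z d u] assms by auto
qed

end

text \<open>A maximal \<open>D \<supseteq> {a, b, c}\<close> all of whose 3-cycles are in \<open>H\<close> is mapped to itself by \<open>y\<close>: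
  otherwise \<open>y ` D\<close>, which meets \<open>D\<close> in \<open>y z\<close>, provides a 3-cycle that enlarges \<open>D\<close>.\<close>

lemma contains_all_cyc3s:
  assumes comp: "\<And>f g. f \<in> H \<Longrightarrow> g \<in> H \<Longrightarrow> f \<circ> g \<in> H"
    and "finite S" and abc: "{a, b, c} \<subseteq> S" "distinct [a, b, c]" "cyc3 a b c \<in> H"
    and y: "y permutes S" "y \<in> H" "inv' y \<in> H"
    and z: "z \<in> {a, b, c}" "y z \<in> {a, b, c}"
    and orb: "\<And>i. i \<in> S \<Longrightarrow> \<exists>k. \<exists>e\<in>{a, b, c}. i = (y ^^ k) e"
  shows "contains_cyc3s H S"
proof -
  define F where "F = {D. {a, b, c} \<subseteq> D \<and> D \<subseteq> S \<and> contains_cyc3s H D}"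
  have "finite F"
    by (rule finite_subset[of _ "Pow S"]) (use \<open>finite S\<close> in \<open>auto simp: F_def\<close>)
  \<comment> \<open>The six orderings of the three points are the rotations of
    \<open>a, b, c\<close> and of its reverse.\<close>
  moreover have "{a, b, c} \<in> F"
    using abc reverse_closed[OF comp, of a b c] cyc3_rotate[of a b c] cyc3_rotate[of b c a]
      cyc3_rotate[of c b a] cyc3_rotate[of b a c]
    by (auto simp: F_def contains_cyc3s_def)
  ultimately obtain D where D: "D \<in> F" and maximal: "\<forall>E\<in>F. D \<subseteq> E \<longrightarrow> D = E"
    using finite_has_maximal2[of F "{a, b, c}"] by (metis)
  have bij: "bij y"
    using y(1) permutes_bij by blast
  have full: "contains_cyc3s H (y ` D)"
  proof -
    have "cyc3 (y p) (y q) (y r) \<in> H" if "p \<in> D" "q \<in> D" "r \<in> D" "distinct [p, q, r]" for p q r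
    proof -
      have "cyc3 p q r \<in> H"
        using that D by (auto simp: F_def contains_cyc3s_def)
      then have "y \<circ> cyc3 p q r \<circ> inv' y \<in> H"
        using comp y by simp
      then show ?thesis
        using cyc3_conj[OF that(4) bij] by simp
    qed
    then show ?thesis
      by (auto simp: contains_cyc3s_def)
  qed
  have "y ` D \<subseteq> D"
  proof (rule ccontr)
    assume "\<not> y ` D \<subseteq> D"
    then obtain u where u: "u \<in> y ` D" "u \<notin> D"
      by blast
    have yz: "y z \<in> D" "y z \<in> y ` D"
      using z D by (auto simp: F_def)
    have "card (y ` D) = card D"
      using bij by (meson bij_is_inj card_image inj_on_subset subset_UNIV)
    moreover have "card {a, b, c} \<le> card D"
      using D \<open>finite S\<close> by (intro card_mono) (auto simp: F_def finite_subset)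
    \<comment> \<open>The image of \<open>D\<close> under \<open>y\<close> has as many points as
      \<open>D\<close>, hence at least three, so it contains a point besides \<open>y z\<close> and
      \<open>u\<close>.\<close>
    ultimately have "card {y z, u} < card (y ` D)"
      using abc(2) by (auto simp: card_insert_if)
    then obtain v where v: "v \<in> y ` D" "v \<noteq> y z" "v \<noteq> u"
      by (metis card_mono finite.emptyI finite.insertI insertCI linorder_not_less subsetI)
    have dis: "distinct [y z, u, v]"
      using u yz v by auto
    then have "cyc3 (y z) u v \<in> H"
      by (rule full[unfolded contains_cyc3s_def, rule_format, OF yz(2) u(1) v(1)])
    moreover obtain d e where "{d, e} \<subseteq> D" "distinct [y z, d, e]"
      using z(2) abc(2) D by (auto simp: F_def)
    ultimately have "contains_cyc3s H (insert u D)"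
      using contains_cyc3s_insert[OF comp, of D "y z" d e u v] D dis u yz
      by (auto simp: F_def)
    moreover have "u \<in> S"
      using u D y(1) by (auto simp: F_def permutes_in_image)
    ultimately have "insert u D \<in> F"
      using D by (auto simp: F_def)
    then show False
      using maximal u by blast
  qed
  \<comment> \<open>\<open>D\<close> is invariant under \<open>y\<close> and contains
    \<open>{a, b, c}\<close>, which meets every cycle of \<open>y\<close> on
    \<open>S\<close>.\<close>
  then have "(y ^^ k) e \<in> D" if "e \<in> D" for k e
    using that by (induction k) auto
  then have "S \<subseteq> D"
    using orb D by (fastforce simp: F_def)
  then show ?thesis
    using D by (auto simp: F_def)
qed

section \<open>Products of 3-cycles: even permutations and transitivity on triples\<close>

text \<open>Composing \<open>p\<close> with a 3-cycle that sends \<open>p s\<close> back to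
  \<open>s\<close> makes \<open>s\<close> a fixed point, so one factor removes one point.\<close>

lemma evenperm_prod_cyc3:
  assumes "finite S" "p permutes S" "evenperm p" "contains_cyc3s C S"
  shows "\<exists>fs. length fs \<le> card S \<and> set fs \<subseteq> C \<and> p = foldr (\<circ>) fs id"
  using assms
proof (induction S arbitrary: p rule: finite_induct)
  case empty
  then show ?case by simp
next
  case (insert s S)
  have C: "contains_cyc3s C S"
    using insert.prems(3) by (auto simp: contains_cyc3s_def)
  show ?case
  proof (cases "p s = s")
    case True
    then have "p permutes S"
      using permutes_superset[OF insert.prems(1), of S] insert.hyps by auto
    then obtain fs where "length fs \<le> card S" "p = foldr (\<circ>) fs id" "set fs \<subseteq> C"
      using insert.IH insert.prems C by blast
    moreover have "card S \<le> card (insert s S)"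
      using insert.hyps by simp
    ultimately show ?thesis
      using le_trans by blast
  next
    case False
    define t where "t = p s"
    have t: "t \<in> S" "t \<noteq> s"
      using False insert.prems(1) permutes_in_image[OF insert.prems(1), of s] by (auto simp: t_def)
    \<comment> \<open>A third point exists, for otherwise \<open>p\<close> would be the
      transposition of \<open>s\<close> and \<open>t\<close>, which is odd.\<close>
    have "\<exists>r. r \<in> S \<and> r \<noteq> t"
    proof (rule ccontr)
      assume "\<nexists>r. r \<in> S \<and> r \<noteq> t"
      then have "S = {t}"
        using t by blast
      then have p: "p permutes {s, t}"
        using insert.prems by simp
      then have "p t \<in> {s, t}" "p t \<noteq> p s"
        using t permutes_in_image[OF p] permutes_inj[OF p] by (auto simp: inj_eq)
      then have "p = transpose s t"
        using permutes_not_in[OF p] by (auto simp: fun_eq_iff t_def Transposition.transpose_def)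
      then show False
        using insert.prems(2) t by (simp add: evenperm_swap)
    qed
    then obtain r where r: "r \<in> S" "r \<noteq> t" by blast
    then have dis: "distinct [t, s, r]"
      using t insert.hyps by auto
    let ?c = "cyc3 t s r"
    have c: "?c permutes insert s S"
      using t r by (intro cyc3_permutes) auto
    then have q: "?c \<circ> p permutes insert s S"
      using insert.prems permutes_compose by blast
    have "(?c \<circ> p) s = s"
      using dis by (simp add: cyc3_apply flip: t_def)
    then have "?c \<circ> p permutes S"
      using permutes_superset[OF q, of S] insert.hyps by auto
    moreover have "evenperm (?c \<circ> p)"
    proof -
      have fin: "finite (insert s S)"
        using insert.hyps by simp
      have "permutation ?c" "permutation p"
        using permutes_imp_permutation[OF fin] c insert.prems by blast+
      then show ?thesis
        using evenperm_comp evenperm_cyc3[OF dis] insert.prems by blast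
    qed
    ultimately obtain fs where fs: "length fs \<le> card S" "?c \<circ> p = foldr (\<circ>) fs id" "set fs \<subseteq> C"
      using insert.IH C by blast
    have "p = cyc3 r s t \<circ> (?c \<circ> p)"
      using permutes_inv_o(2)[OF c] by (simp add: inv_cyc3[OF dis] o_assoc)
    then have "p = foldr (\<circ>) (cyc3 r s t # fs) id"
      using fs(2) by simp
    moreover have "cyc3 r s t \<in> C"
      using t r dis insert.prems(3) by (auto simp: contains_cyc3s_def)
    moreover have "length (cyc3 r s t # fs) \<le> card (insert s S)"
      using fs insert.hyps by simp
    ultimately show ?thesis
      using fs(3) by (metis insert_subset list.simps(15))
  qed
qed

text \<open>Besides \<open>u\<close>, \<open>v\<close> and the at most two points of
  \<open>F\<close>, one of the at least five points is left to complete a 3-cycle.\<close>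

lemma cyc3s_move_point:
  assumes "contains_cyc3s H S" "id \<in> H" "5 \<le> card S"
    and "F \<subseteq> S" "card F \<le> 2" "u \<in> S - F" "v \<in> S - F"
  shows "\<exists>h\<in>H. h permutes S \<and> h u = v \<and> (\<forall>f\<in>F. h f = f)"
proof (cases "u = v")
  case True
  then show ?thesis
    using assms permutes_id by (intro bexI[of _ id]) auto
next
  case False
  have "finite S"
    using assms(3) card.infinite by fastforce
  then have "finite F"
    using assms finite_subset by blast
  then have "card (insert u (insert v F)) < card S"
    using assms by (auto simp: card_insert_if)
  then obtain z where z: "z \<in> S" "z \<notin> insert u (insert v F)"
    using \<open>finite F\<close> by (metis card_mono finite.insertI linorder_not_less subsetI)
  then have dis: "distinct [u, v, z]"
    using False by auto
  then have "cyc3 u v z \<in> H"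
    using assms z by (simp add: contains_cyc3s_def)
  moreover have "cyc3 u v z permutes S"
    using assms z by (intro cyc3_permutes) auto
  ultimately show ?thesis
    using assms z dis by (intro bexI[of _ "cyc3 u v z"]) (auto intro!: cyc3_apply simp: cyc3_apply)
qed

text \<open>The three points are put in place one after another, each later map fixing those already
  placed; the last map fixes two, as many as \<open>cyc3s_move_point\<close> allows.\<close>

lemma cyc3s_move_triple:
  assumes comp: "\<And>f g. f \<in> H \<Longrightarrow> g \<in> H \<Longrightarrow> f \<circ> g \<in> H"
    and H: "contains_cyc3s H S" "id \<in> H" "5 \<le> card S"
    and abc: "{a, b, c} \<subseteq> S" "distinct [a, b, c]"
    and pqr: "{p, q, r} \<subseteq> S" "distinct [p, q, r]"
  shows "\<exists>h\<in>H. h a = p \<and> h b = q \<and> h c = r"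
proof -
  obtain f where f: "f \<in> H" "f permutes S" "f a = p"
    using cyc3s_move_point[OF H, of "{}" a p] abc pqr by auto
  have fb: "f b \<in> S" "f b \<noteq> p" "f c \<in> S" "f c \<noteq> p" "f b \<noteq> f c"
    using abc f permutes_in_image[OF f(2)] permutes_inj[OF f(2)] by (auto simp: inj_eq)
  obtain g where g: "g \<in> H" "g permutes S" "g (f b) = q" "g p = p"
    using cyc3s_move_point[OF H, of "{p}" "f b" q] fb pqr by auto
  have gc: "g (f c) \<in> S" "g (f c) \<noteq> p" "g (f c) \<noteq> q"
    using fb g permutes_in_image[OF g(2)] permutes_inj[OF g(2)] by (auto dest: injD)
  obtain h where h: "h \<in> H" "h permutes S" "h (g (f c)) = r" "h p = p" "h q = q"
    using cyc3s_move_point[OF H, of "{p, q}" "g (f c)" r] gc pqr by (auto simp: card_insert_if)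
  show ?thesis
    using comp[OF comp[OF h(1) g(1)] f(1)] f g h by (intro bexI[of _ "h \<circ> g \<circ> f"]) auto
qed

section \<open>The diameter for a suitable pair of generators\<close>

text \<open>\<open>y_step\<close> and \<open>y_orbits\<close> are hypotheses of
  \<open>contains_all_cyc3s\<close>; the facts \<open>y_pow\<close> and \<open>m\<close> isolate
  \<open>x\<close> in the first coordinate and keep the words short.\<close>

locale cyc3_pair =
  fixes n m a b c :: nat and y :: "nat \<Rightarrow> nat"
  assumes n: "5 \<le> n"
    and abc: "{a, b, c} \<subseteq> {1..n}" "distinct [a, b, c]"
    and y_permutes: "y permutes {1..n}"
    and y_even: "evenperm y"
    and y_pow: "y ^^ m = id"
    and m: "m \<le> n" "\<not> 3 dvd m"
    and y_step: "\<exists>z\<in>{a, b, c}. y z \<in> {a, b, c}"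
    and y_orbits: "i \<in> {1..n} \<Longrightarrow> \<exists>k. \<exists>e\<in>{a, b, c}. i = (y ^^ k) e"
begin

abbreviation x where "x \<equiv> cyc3 a b c"
abbreviation G where "G \<equiv> alt_group n \<times>\<times> alt_group n"
abbreviation S where "S \<equiv> {(x, y), (y, x)}"

section \<open>Words of bounded length in the generators\<close>

definition word_ball :: "nat \<Rightarrow> ((nat \<Rightarrow> nat) \<times> (nat \<Rightarrow> nat)) set"
  where "word_ball k = {word_prod G w | w. w \<in> lists S \<and> length w \<le> k}"

lemma word_prod_append:
  "word_prod G (v @ w) = word_prod G v \<otimes>\<^bsub>G\<^esub> word_prod G w"
  by (induction v) (simp_all add: word_prod_def mult_DirProd' alt_group_mult alt_group_one o_assoc)

lemma word_ball_mono: "u \<in> word_ball j \<Longrightarrow> j \<le> k \<Longrightarrow> u \<in> word_ball k"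
  using le_trans unfolding word_ball_def by blast

lemma word_ball_comp:
  assumes "(f, g) \<in> word_ball j" "(f', g') \<in> word_ball k"
  shows "(f \<circ> f', g \<circ> g') \<in> word_ball (j + k)"
proof -
  obtain v w where "word_prod G v = (f, g)" "v \<in> lists S" "length v \<le> j"
    "word_prod G w = (f', g')" "w \<in> lists S" "length w \<le> k"
    using assms unfolding word_ball_def mem_Collect_eq by metis
  then show ?thesis
    unfolding word_ball_def
    by (intro CollectI exI[of _ "v @ w"]) (auto simp: word_prod_append alt_group_mult)
qed

lemma word_ball_id: "(id, id) \<in> word_ball 0"
  by (auto simp: word_ball_def word_prod_def alt_group_one)

lemma word_ball_gen: "u \<in> S \<Longrightarrow> u \<in> word_ball 1"
  unfolding word_ball_def
  by (intro CollectI exI[of _ "[u]"]) (auto simp: word_prod_def alt_group_one alt_group_mult)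

lemma word_ball_pow: "(f, g) \<in> word_ball j \<Longrightarrow> (f ^^ k, g ^^ k) \<in> word_ball (k * j)"
  by (induction k) (auto simp: word_ball_id dest: word_ball_comp)

text \<open>\<open>S\<close> is invariant under exchanging the coordinates, so this can be done in
  every letter of a word.\<close>

lemma word_ball_swap: "(f, g) \<in> word_ball k \<Longrightarrow> (g, f) \<in> word_ball k"
proof -
  have swap: "word_prod G (map prod.swap w) = prod.swap (word_prod G w)" for w
    by (induction w) (auto simp: word_prod_def mult_DirProd')
  assume "(f, g) \<in> word_ball k"
  then obtain w where "(f, g) = word_prod G w" "w \<in> lists S" "length w \<le> k"
    unfolding word_ball_def by auto
  then show ?thesis
    unfolding word_ball_def
    by (intro CollectI exI[of _ "map prod.swap w"]) (auto simp: swap simp flip: \<open>(f, g) = word_prod G w\<close>)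
qed

lemma x_permutes: "x permutes {1..n}"
  by (rule cyc3_permutes) (rule abc)

lemma x_cube: "x ^^ (3 * k) = id"
proof -
  have "x ^^ 3 = id"
    using cyc3_cube[OF abc(2)] by (simp add: numeral_3_eq_3 o_assoc)
  then show ?thesis
    by (metis funpow_mult id_funpow)
qed

lemma y_pow_mult: "y ^^ (m * k) = id"
  by (metis funpow_mult id_funpow y_pow)

lemma x_pow: "x ^^ (m * m) = x"
proof -
  have "m mod 3 = 1 \<or> m mod 3 = 2"
    using m(2) by presburger
  then have "(m mod 3) * (m mod 3) mod 3 = 1"
    by auto
  then have "m * m mod 3 = 1"
    by (simp only: mod_mult_eq)
  then obtain j where "m * m = Suc (3 * j)"
    by (metis Suc_eq_plus1 add.commute mod_mult_div_eq)
  then show ?thesis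
    using x_cube by simp
qed

lemma x_in_word_ball: "(x, id) \<in> word_ball (m * m)"
  using word_ball_pow[OF word_ball_gen[of "(x, y)"], of "m * m"] x_pow y_pow_mult[of m] by simp

text \<open>\<open>3 * m\<close> is a period of both \<open>x\<close> and \<open>y\<close>. A common
  exponent is required because a power of a generator raises both coordinates at once.\<close>

lemma inv_gens:
  "inv' x = x ^^ (3 * m - 1)" "inv' y = y ^^ (3 * m - 1)"
proof -
  \<comment> \<open>\<open>\<not> 3 dvd m\<close> excludes \<open>m = 0\<close>, where the
    subtraction would be truncated.\<close>
  have "Suc (3 * m - 1) = 3 * m"
    using m(2) by (cases m) auto
  moreover have "inv' f = f ^^ k" if "f ^^ Suc k = id" for f :: "nat \<Rightarrow> nat" and k
    using that by (intro inv_unique_comp) (metis funpow.simps(2), metis funpow_Suc_right)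
  ultimately show "inv' x = x ^^ (3 * m - 1)" "inv' y = y ^^ (3 * m - 1)"
    using x_cube[of m] y_pow_mult[of 3] by (metis mult.commute)+
qed

lemma inv_gens_in_word_ball:
  assumes "(f, g) \<in> S"
  shows "(inv' f, inv' g) \<in> word_ball (3 * n)"
proof -
  have "(inv' f, inv' g) \<in> word_ball ((3 * m - 1) * 1)"
    using assms word_ball_pow[OF word_ball_gen[OF assms], of "3 * m - 1"] inv_gens by auto
  then show ?thesis
    using m(1) by (auto elim: word_ball_mono)
qed

section \<open>Paths in the action on triples\<close>

definition triple_step :: "((nat \<times> nat \<times> nat) \<times> nat \<times> nat \<times> nat) set"
  where "triple_step = {((p, q, r), (s p, s q, s r)) | p q r s. {p, q, r} \<subseteq> {1..n} \<and> s \<in> {x, y}}"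

lemma triple_step_subset:
  "triple_step \<subseteq> ({1..n} \<times> {1..n} \<times> {1..n}) \<times> {1..n} \<times> {1..n} \<times> {1..n}"
  using permutes_in_image[OF x_permutes] permutes_in_image[OF y_permutes]
  unfolding triple_step_def by blast

lemma finite_triple_step: "finite triple_step"
  using triple_step_subset finite_subset by blast

text \<open>A crude count: \<open>n ^ 3\<close> triples form \<open>n ^ 6\<close> pairs. The number
  of edges later bounds the length of a path.\<close>

lemma card_triple_step: "card triple_step \<le> n ^ 6"
  using card_mono[OF _ triple_step_subset]
  by (simp add: card_cartesian_product eval_nat_numeral mult.assoc)

text \<open>The maps of \<open>{1..n}\<close> into itself that send every triple to one reachable
  from it are closed under composition and contain \<open>x\<close> and \<open>y\<close>. By
  \<open>contains_all_cyc3s\<close> they include all 3-cycles, and \<open>cyc3s_move_triple\<close>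
  applies.\<close>

lemma triple_reachable:
  assumes "{p, q, r} \<subseteq> {1..n}" "distinct [p, q, r]"
  shows "((a, b, c), (p, q, r)) \<in> triple_step\<^sup>*"
proof -
  define H where "H = {h. h ` {1..n} \<subseteq> {1..n} \<and>
    (\<forall>p q r. {p, q, r} \<subseteq> {1..n} \<longrightarrow> ((p, q, r), (h p, h q, h r)) \<in> triple_step\<^sup>*)}"
  have comp: "f \<circ> g \<in> H" if "f \<in> H" "g \<in> H" for f g
  proof -
    have "((p, q, r), (f (g p), f (g q), f (g r))) \<in> triple_step\<^sup>*" if *: "{p, q, r} \<subseteq> {1..n}" for p q r
    proof -
      have "g ` {1..n} \<subseteq> {1..n}"
        using \<open>g \<in> H\<close> by (simp add: H_def)
      then have "{g p, g q, g r} \<subseteq> {1..n}"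
        using * by blast
      then have "((g p, g q, g r), (f (g p), f (g q), f (g r))) \<in> triple_step\<^sup>*"
        using \<open>f \<in> H\<close> by (simp add: H_def)
      moreover have "((p, q, r), (g p, g q, g r)) \<in> triple_step\<^sup>*"
        using * \<open>g \<in> H\<close> by (simp add: H_def)
      ultimately show ?thesis
        by (rule rtrancl_trans[rotated])
    qed
    moreover have "f ` {1..n} \<subseteq> {1..n}" "g ` {1..n} \<subseteq> {1..n}"
      using that by (simp_all add: H_def)
    then have "(f \<circ> g) ` {1..n} \<subseteq> {1..n}"
      unfolding image_subset_iff o_apply by blast
    ultimately show ?thesis
      by (simp add: H_def)
  qed
  have id: "id \<in> H"
    by (simp add: H_def)
  have gen: "s \<in> H" if s: "s \<in> {x, y}" for s
  proof -
    have "((p, q, r), (s p, s q, s r)) \<in> triple_step" if "{p, q, r} \<subseteq> {1..n}" for p q r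
      using s that unfolding triple_step_def by blast
    moreover have "s ` {1..n} \<subseteq> {1..n}"
      using s permutes_image[OF x_permutes] permutes_image[OF y_permutes] by auto
    ultimately show ?thesis
      by (simp add: H_def r_into_rtrancl)
  qed
  then have gens: "x \<in> H" "y \<in> H"
    by simp_all
  \<comment> \<open>This gives \<open>inv' y\<close>, which is a power of \<open>y\<close>.\<close>
  have "y ^^ k \<in> H" for k
    using id gens comp by (induction k) auto
  then have "inv' y \<in> H"
    using inv_gens by simp
  moreover obtain z where "z \<in> {a, b, c}" "y z \<in> {a, b, c}"
    using y_step by blast
  ultimately have "contains_cyc3s H {1..n}"
    using contains_all_cyc3s[OF comp _ abc gens(1) y_permutes gens(2)] y_orbits by blast
  then obtain h where "h \<in> H" "h a = p" "h b = q" "h c = r"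
    using cyc3s_move_triple[OF comp _ id _ abc assms] n by auto
  then show ?thesis
    using abc by (auto simp: H_def)
qed

text \<open>Every edge lifts to the generator whose first coordinate acts along it. Nothing is known
  about the second coordinate \<open>g\<close>, but the inverse pair is recorded too, so that
  \<open>g\<close> cancels under conjugation; inverting a letter costs at most \<open>3 * n\<close>
  letters.\<close>

lemma triple_path_word:
  assumes "((a, b, c), t) \<in> triple_step ^^ k"
  shows "\<exists>f g. t = (f a, f b, f c) \<and> bij f \<and> bij g \<and>
    (f, g) \<in> word_ball k \<and> (inv' f, inv' g) \<in> word_ball (k * (3 * n))"
  using assms
proof (induction k arbitrary: t)
  case 0
  then have "t = (id a, id b, id c)"
    by simp
  moreover have "(inv' id, inv' id) \<in> word_ball (0 * (3 * n))"
    using word_ball_id by (simp only: inv_id mult_0)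
  ultimately show ?case
    using word_ball_id bij_id by blast
next
  case (Suc k)
  then obtain u where u: "((a, b, c), u) \<in> triple_step ^^ k" "(u, t) \<in> triple_step"
    by auto
  then obtain f g where fg: "u = (f a, f b, f c)" "bij f" "bij g"
    "(f, g) \<in> word_ball k" "(inv' f, inv' g) \<in> word_ball (k * (3 * n))"
    using Suc.IH by blast
  obtain s where s: "t = (s (f a), s (f b), s (f c))" "s \<in> {x, y}"
    using u fg by (auto simp: triple_step_def)
  then obtain s' where s': "(s, s') \<in> S"
    by auto
  then have bij: "bij s" "bij s'"
    using permutes_bij[OF x_permutes] permutes_bij[OF y_permutes] by auto
  have "(s \<circ> f, s' \<circ> g) \<in> word_ball (Suc k)"
    using word_ball_comp[OF word_ball_gen[OF s'] fg(4)] by simp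
  moreover have "(inv' (s \<circ> f), inv' (s' \<circ> g)) \<in> word_ball (Suc k * (3 * n))"
    using word_ball_comp[OF fg(5) inv_gens_in_word_ball[OF s']] fg bij
    by (simp add: o_inv_distrib add.commute)
  moreover have "bij (s \<circ> f)" "bij (s' \<circ> g)"
    using fg bij by (auto intro: bij_comp)
  moreover have "t = ((s \<circ> f) a, (s \<circ> f) b, (s \<circ> f) c)"
    using s by simp
  ultimately show ?case
    by blast
qed

text \<open>Conjugating \<open>(x, id)\<close> by \<open>(f, g)\<close> relabels the 3-cycle and
  leaves the second coordinate trivial.\<close>

lemma cyc3_in_word_ball:
  assumes "{p, q, r} \<subseteq> {1..n}" "distinct [p, q, r]"
  shows "(cyc3 p q r, id) \<in> word_ball (5 * n ^ 7)"
proof -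
  \<comment> \<open>In a finite relation, whatever is reachable is reached in at most as many steps
    as there are edges.\<close>
  obtain k where k: "k \<le> card triple_step" "((a, b, c), (p, q, r)) \<in> triple_step ^^ k"
    using triple_reachable[OF assms] rtrancl_finite_eq_relpow[OF finite_triple_step] by auto
  then obtain f g where fg: "(p, q, r) = (f a, f b, f c)" "bij f" "bij g"
    "(f, g) \<in> word_ball k" "(inv' f, inv' g) \<in> word_ball (k * (3 * n))"
    using triple_path_word by blast
  have "(f \<circ> x \<circ> inv' f, g \<circ> id \<circ> inv' g) \<in> word_ball (k + m * m + k * (3 * n))"
    by (intro word_ball_comp fg x_in_word_ball)
  moreover have "f \<circ> x \<circ> inv' f = cyc3 p q r"
    using cyc3_conj[OF abc(2) fg(2)] fg(1) by simp
  moreover have "g \<circ> id \<circ> inv' g = id"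
    using fg(3) by (simp add: surj_iff[symmetric] bij_is_surj)
  \<comment> \<open>The three summands are at most \<open>n ^ 7\<close>, \<open>n ^ 7\<close> and
    \<open>3 * n ^ 7\<close>.\<close>
  moreover have "k + m * m + k * (3 * n) \<le> 5 * n ^ 7"
  proof -
    have "k \<le> n ^ 6"
      using k card_triple_step by simp
    moreover have "m * m \<le> n ^ 2"
      using m by (simp add: power2_eq_square mult_mono)
    moreover have "n ^ 6 \<le> n ^ 7" "n ^ 2 \<le> n ^ 7"
      using n by (auto intro!: power_increasing)
    moreover have "k * n \<le> n ^ 7"
      using mult_right_mono[OF \<open>k \<le> n ^ 6\<close>, of n] by (simp add: eval_nat_numeral mult.commute)
    ultimately show ?thesis
      by linarith
  qed
  ultimately show ?thesis
    using word_ball_mono by metis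
qed

section \<open>The diameter bound\<close>

lemma evenperm_in_word_ball:
  assumes "p permutes {1..n}" "evenperm p"
  shows "(p, id) \<in> word_ball (5 * n ^ 8)"
proof -
  define C where "C = {f. (f, id) \<in> word_ball (5 * n ^ 7)}"
  have C: "(f, id) \<in> word_ball (5 * n ^ 7)" if "f \<in> C" for f
    using that unfolding C_def by (rule CollectD)
  have "contains_cyc3s C {1..n}"
    unfolding contains_cyc3s_def C_def using cyc3_in_word_ball by blast
  then obtain fs where fs: "length fs \<le> n" "p = foldr (\<circ>) fs id" "set fs \<subseteq> C"
    using evenperm_prod_cyc3[OF _ assms] by auto
  from fs(3) have "(foldr (\<circ>) fs id, id) \<in> word_ball (length fs * (5 * n ^ 7))"
  proof (induction fs)
    case Nil
    show ?case
      using word_ball_id by (simp add: id_def)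
  next
    case (Cons f fs)
    then have "(f, id) \<in> word_ball (5 * n ^ 7)"
      by (intro C) simp
    moreover have "(foldr (\<circ>) fs id, id) \<in> word_ball (length fs * (5 * n ^ 7))"
      using Cons.prems by (intro Cons.IH) simp
    ultimately have "(f \<circ> foldr (\<circ>) fs id, id \<circ> id) \<in> word_ball (5 * n ^ 7 + length fs * (5 * n ^ 7))"
      by (rule word_ball_comp)
    moreover have "foldr (\<circ>) (f # fs) id = f \<circ> foldr (\<circ>) fs id"
      by simp
    moreover have "length (f # fs) * (5 * n ^ 7) = 5 * n ^ 7 + length fs * (5 * n ^ 7)"
      by simp
    ultimately show ?case
      by (simp only: comp_id)
  qed
  moreover have "length fs * (5 * n ^ 7) \<le> 5 * n ^ 8"
    using mult_right_mono[OF fs(1), of "5 * n ^ 7"] by (simp add: eval_nat_numeral algebra_simps)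
  ultimately show ?thesis
    using word_ball_mono fs(2) by metis
qed

lemma carrier_in_word_ball:
  assumes "u \<in> carrier G"
  shows "u \<in> word_ball (10 * n ^ 8)"
proof -
  obtain p q where u: "u = (p, q)" "p permutes {1..n}" "evenperm p" "q permutes {1..n}" "evenperm q"
    using assms by (auto simp: alt_group_carrier)
  have "(p \<circ> id, id \<circ> q) \<in> word_ball (5 * n ^ 8 + 5 * n ^ 8)"
    using u by (intro word_ball_comp word_ball_swap[of q] evenperm_in_word_ball)
  then show ?thesis
    using u by simp
qed

lemma generating_set_S: "generating_set G S"
proof -
  have "S \<subseteq> carrier G"
    using x_permutes y_permutes y_even evenperm_cyc3[OF abc(2)] by (auto simp: alt_group_carrier)
  then show ?thesis
    using carrier_in_word_ball unfolding generating_set_def word_ball_def by blast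
qed

lemma card_S: "card S = 2"
proof -
  \<comment> \<open>The power \<open>m * m\<close> leaves \<open>x\<close> unchanged but turns
    \<open>y\<close> into the identity.\<close>
  have "x \<noteq> y"
  proof
    assume "x = y"
    then have "x = id"
      using x_pow y_pow_mult by metis
    then show False
      using cyc3_apply(1)[OF abc(2)] abc(2) by simp
  qed
  then show ?thesis by simp
qed

lemma diam_S: "diam G S \<le> 10 * n ^ 8"
proof -
  have "finite (carrier (alt_group n))"
    by (rule finite_subset[OF _ finite_permutations[of "{1..n}"]]) (auto simp: alt_group_carrier)
  then have "finite (word_length G S ` carrier G)"
    by simp
  moreover have "carrier G \<noteq> {}"
    using alt_group_is_group[of n] by (auto dest: group.is_monoid monoid.one_closed)
  moreover have "word_length G S u \<le> 10 * n ^ 8" if u: "u \<in> carrier G" for u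
  proof -
    obtain w where w: "u = word_prod G w" "w \<in> lists S" "length w \<le> 10 * n ^ 8"
      using carrier_in_word_ball[OF u] unfolding word_ball_def mem_Collect_eq by metis
    then have "word_length G S u \<le> length w"
      unfolding word_length_def by (intro Least_le) auto
    then show ?thesis
      using w by simp
  qed
  ultimately show ?thesis
    unfolding diam_def by (subst Max_le_iff) auto
qed

end

section \<open>Choice of the second generator\<close>

lemma evenperm_cycle_of_list:
  assumes "distinct cs"
  shows "evenperm (cycle_of_list cs) = even (length cs - 1)"
  using swapidseq_ext_imp_swapidseq[OF swapidseq_ext_of_cycles[OF assms]]
  by (intro evenperm_unique) auto

lemma funpow_comp_commute:
  assumes "f \<circ> g = g \<circ> f"
  shows "(f \<circ> g) ^^ k = f ^^ k \<circ> g ^^ k"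
proof (induction k)
  case (Suc k)
  have "f ^^ k \<circ> g = g \<circ> f ^^ k"
  proof (induction k)
    case (Suc k)
    then show ?case
      using assms by (metis funpow.simps(2) o_assoc)
  qed simp
  then show ?case
    using Suc by (metis funpow.simps(2) o_assoc)
qed simp

lemma cycle_upt_funpow:
  assumes "k < L"
  shows "(cycle_of_list [1..<Suc L] ^^ k) 1 = Suc k"
proof -
  let ?cs = "[1..<Suc L]"
  \<comment> \<open>Applied entrywise, the \<open>k\<close>-th power rotates the list by
    \<open>k\<close>, so the entry at index 0 goes to the one at index \<open>k\<close>, which is
    \<open>Suc k\<close>.\<close>
  have "(cycle_of_list ?cs ^^ k) (?cs ! 0) = map (cycle_of_list ?cs ^^ k) ?cs ! 0"
    using assms by (subst nth_map) auto
  also have "\<dots> = rotate k ?cs ! 0"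
    by (subst cyclic_rotation) auto
  also have "\<dots> = ?cs ! k"
    using assms by (subst nth_rotate) auto
  finally show ?thesis
    using assms by (simp del: upt_Suc)
qed

lemma cycle_upt_permutes: "L \<le> n \<Longrightarrow> cycle_of_list [1..<Suc L] permutes {1..n}"
  by (rule permutes_subset[OF cycle_permutes]) (auto simp del: upt_Suc)

lemma cycle_upt_pow: "cycle_of_list [1..<Suc L] ^^ L = id"
  using cycle_is_id_root[of "[1..<Suc L]"] by (simp del: upt_Suc)

lemma evenperm_cycle_upt: "odd L \<Longrightarrow> evenperm (cycle_of_list [1..<Suc L])"
  by (subst evenperm_cycle_of_list) (auto simp del: upt_Suc)

text \<open>One factor \<open>n\<close> stays outside the exponential and \<open>n ^ 7\<close> goes
  into it. With \<open>ln (ln n) \<ge> 1/4\<close>, the constant 27 is chosen so that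
  \<open>(27 + 1) / 4 = 7\<close>.\<close>

lemma ten_power_le_exp:
  assumes "5 \<le> n"
  shows "10 * real n ^ 8 \<le> 10 * real n * exp ((27 + 1) * ln (real n) ^ 4 * ln (ln (real n)))"
proof -
  define l where "l = ln (real n)"
  \<comment> \<open>From \<open>exp 1 \<le> 3\<close>, the fourth power is at most 81, below
    125.\<close>
  have "exp (4 / 3 :: real) ^ 3 = exp 1 ^ 4"
    by (simp flip: exp_of_nat_mult)
  also have "\<dots> < 5 ^ 3"
    using power_mono[OF exp_le, of 4] by simp
  finally have "exp (4 / 3 :: real) < 5"
    by (rule power_less_imp_less_base) simp
  then have l: "4 / 3 \<le> l"
    unfolding l_def using assms by (subst ln_ge_iff) auto
  have "1 / 4 \<le> ln (4 / 3 :: real)"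
    using ln_le_minus_one[of "3 / 4 :: real"] ln_inverse[of "4 / 3 :: real"] by simp
  also have "\<dots> \<le> ln l"
    using l by simp
  finally have "1 / 4 \<le> ln l" .
  moreover have "l ^ 1 \<le> l ^ 4"
    using l by (intro power_increasing) auto
  ultimately have "l * (1 / 4) \<le> l ^ 4 * ln l"
    using l by (intro mult_mono) auto
  then have "real 7 * l \<le> (27 + 1) * l ^ 4 * ln l"
    by (simp add: mult_ac)
  then have "exp (real 7 * l) \<le> exp ((27 + 1) * l ^ 4 * ln l)"
    by simp
  moreover have "exp (real 7 * l) = real n ^ 7"
    using assms by (simp only: exp_of_nat_mult l_def) simp
  ultimately have "real n * real n ^ 7 \<le> real n * exp ((27 + 1) * l ^ 4 * ln l)"
    by (intro mult_left_mono) (simp_all only: of_nat_0_le_iff)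
  then show ?thesis
    by (simp add: l_def flip: power_Suc)
qed

text \<open>The cycles of \<open>y\<close>, fixed points included, must have lengths prime to 3; there are at most
  three of them, as each contains a point moved by the 3-cycle, and \<open>y\<close> is even iff their number has
  the parity of \<open>n\<close>.\<close>

lemma ex_cyc3_pair:
  assumes n: "5 \<le> n"
  shows "\<exists>m a b c y. cyc3_pair n m a b c y"
proof -
  let ?C = "\<lambda>L. cycle_of_list [1..<Suc L]"
  have orbit: "i = (?C L ^^ (i - 1)) 1" if "1 \<le> i" "i \<le> L" for i L
    using cycle_upt_funpow[of "i - 1" L] that by simp
  have outside: "?C L i = i" if "L < i" for i L
    using that by (intro id_outside_supp) (auto simp del: upt_Suc)
  have step: "?C L 1 = 2" if "1 < L" for L
    using cycle_upt_funpow[of 1 L] that by simp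
  consider "n mod 3 \<noteq> 2" "odd n" | "n mod 3 \<noteq> 2" "even n" | "n mod 3 = 2" "odd n" | "n mod 3 = 2" "even n"
    by blast
  then show ?thesis
  proof cases
    case 1
    \<comment> \<open>The cycle has odd length \<open>n - 2\<close>, which is prime to 3; the
      3-cycle joins it to both fixed points.\<close>
    have "cyc3_pair n (n - 2) 1 (n - 1) n (?C (n - 2))"
    proof
      fix i
      assume "i \<in> {1..n}"
      then have "i \<le> n - 2 \<or> i = (?C (n - 2) ^^ 0) i \<and> i \<in> {1, n - 1, n}"
        by auto
      then show "\<exists>k. \<exists>e\<in>{1, n - 1, n}. i = (?C (n - 2) ^^ k) e"
        using orbit[of i "n - 2"] \<open>i \<in> {1..n}\<close> by (metis atLeastAtMost_iff insertI1)
    next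
      show "\<not> 3 dvd n - 2"
        using 1 n by presburger
      show "\<exists>z\<in>{1, n - 1, n}. ?C (n - 2) z \<in> {1, n - 1, n}"
        using outside[of "n - 2" n] n by fastforce
    qed (use 1 n in \<open>auto simp: cycle_upt_permutes cycle_upt_pow evenperm_cycle_upt simp del: upt_Suc One_nat_def\<close>)
    then show ?thesis by blast
  next
    case 2
    let ?t = "transpose (n - 1) n"
    \<comment> \<open>Here \<open>n - 2\<close> is even, so the long cycle is odd and the
      transposition restores evenness; its order 2 divides \<open>n - 2\<close>.\<close>
    define y where "y = ?C (n - 2) \<circ> ?t"
    have "distinct [n - 1, n]" "set [1..<Suc (n - 2)] \<inter> set [n - 1, n] = {}"
      using n by (auto simp del: upt_Suc)
    then have "?C (n - 2) \<circ> ?t = ?t \<circ> ?C (n - 2)"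
      using cycles_commute[of "[1..<Suc (n - 2)]" "[n - 1, n]"] by (simp del: upt_Suc)
    then have pow: "y ^^ k = ?C (n - 2) ^^ k \<circ> ?t ^^ k" for k
      unfolding y_def by (rule funpow_comp_commute)
    have "cyc3_pair n (n - 2) 1 (n - 1) n y"
    proof
      fix i
      assume "i \<in> {1..n}"
      have "(?t ^^ k) 1 = 1" for k
        using n by (induction k) auto
      then have "i = (y ^^ (i - 1)) 1" if "i \<le> n - 2"
        using orbit[of i "n - 2"] that \<open>i \<in> {1..n}\<close> by (simp add: pow del: upt_Suc)
      moreover have "i \<le> n - 2 \<or> i = (y ^^ 0) i \<and> i \<in> {1, n - 1, n}"
        using \<open>i \<in> {1..n}\<close> by auto
      ultimately show "\<exists>k. \<exists>e\<in>{1, n - 1, n}. i = (y ^^ k) e"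
        by (metis insertI1)
    next
      show "\<not> 3 dvd n - 2"
        using 2 n by presburger
      have "y (n - 1) = n"
        using outside[of "n - 2" n] n by (simp add: y_def del: upt_Suc)
      then show "\<exists>z\<in>{1, n - 1, n}. y z \<in> {1, n - 1, n}"
        by auto
      have C: "?C (n - 2) permutes {1..n}" and t: "?t permutes {1..n}"
        using n by (auto intro!: cycle_upt_permutes permutes_swap_id simp del: upt_Suc One_nat_def)
      then show "y permutes {1..n}"
        unfolding y_def by (rule permutes_compose[rotated])
      have "\<not> evenperm (?C (n - 2))"
        using 2 n by (subst evenperm_cycle_of_list) (auto simp del: upt_Suc)
      then show "evenperm y"
        using evenperm_comp[OF permutation_of_cycle permutation_swap_id, of "[1..<Suc (n - 2)]" "n - 1" n] n
        by (auto simp: y_def evenperm_swap simp del: upt_Suc)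
      obtain j where j: "n - 2 = 2 * j"
        using 2 by (metis dvdE dvd_diff_nat dvd_refl)
      have "?t ^^ 2 = id"
        by (simp add: numeral_2_eq_2)
      then have "?t ^^ (n - 2) = id"
        by (metis funpow_mult id_funpow j)
      then show "y ^^ (n - 2) = id"
        by (simp add: pow cycle_upt_pow del: upt_Suc One_nat_def)
    qed (use 2 n in auto)
    then show ?thesis by blast
  next
    case 3
    \<comment> \<open>A single cycle through all points: \<open>n\<close> is odd and prime to
      3.\<close>
    have "cyc3_pair n n 1 2 3 (?C n)"
    proof
      show "\<exists>k. \<exists>e\<in>{1, 2, 3}. i = (?C n ^^ k) e" if "i \<in> {1..n}" for i
        using orbit[of i n] that by (metis atLeastAtMost_iff insertI1)
      show "\<not> 3 dvd n"
        using 3 by presburger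
      show "\<exists>z\<in>{1, 2, 3}. ?C n z \<in> {1, 2, 3}"
        using step[of n] n by fastforce
    qed (use 3 n in \<open>auto simp: cycle_upt_permutes cycle_upt_pow evenperm_cycle_upt simp del: upt_Suc One_nat_def\<close>)
    then show ?thesis by blast
  next
    case 4
    \<comment> \<open>Now \<open>n - 1\<close> is odd and congruent to 1 modulo 3; the 3-cycle joins
      the cycle to the fixed point \<open>n\<close>.\<close>
    have "cyc3_pair n (n - 1) 1 2 n (?C (n - 1))"
    proof
      fix i
      assume "i \<in> {1..n}"
      then have "i \<le> n - 1 \<or> i = (?C (n - 1) ^^ 0) i \<and> i \<in> {1, 2, n}"
        by auto
      then show "\<exists>k. \<exists>e\<in>{1, 2, n}. i = (?C (n - 1) ^^ k) e"
        using orbit[of i "n - 1"] \<open>i \<in> {1..n}\<close> by (metis atLeastAtMost_iff insertI1)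
    next
      show "\<not> 3 dvd n - 1"
        using 4 n by presburger
      show "\<exists>z\<in>{1, 2, n}. ?C (n - 1) z \<in> {1, 2, n}"
        using step[of "n - 1"] n by fastforce
    qed (use 4 n cycle_upt_permutes[of "n - 1" n] cycle_upt_pow[of "n - 1"]
        evenperm_cycle_upt[of "n - 1"] in auto)
    then show ?thesis by blast
  qed
qed

theorem theorem4p3:
  shows "\<exists>c K :: real. c > 0 \<and> K > 0 \<and>
    (\<forall>n :: nat. n \<ge> 5 \<longrightarrow>
      (\<exists>S. generating_set (alt_group n \<times>\<times> alt_group n) S \<and> card S = 2 \<and>
        real (diam (alt_group n \<times>\<times> alt_group n) S)
          \<le> K * real n * exp ((c + 1) * (ln (real n)) ^ 4 * ln (ln (real n)))))"
proof (rule exI[of _ 27], rule exI[of _ 10], intro conjI allI impI)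
  fix n :: nat
  assume n: "5 \<le> n"
  obtain m a b c y where "cyc3_pair n m a b c y"
    using ex_cyc3_pair[OF n] by blast
  then interpret cyc3_pair n m a b c y .
  have "real (diam G S) \<le> real (10 * n ^ 8)"
    using diam_S by (rule of_nat_mono)
  then have "real (diam G S) \<le> 10 * real n * exp ((27 + 1) * ln (real n) ^ 4 * ln (ln (real n)))"
    using ten_power_le_exp[OF n] by simp
  then show "\<exists>S. generating_set G S \<and> card S = 2 \<and>
      real (diam G S) \<le> 10 * real n * exp ((27 + 1) * ln (real n) ^ 4 * ln (ln (real n)))"
    using generating_set_S card_S by blast
qed simp_all

end
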